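(* Let $(X,d)$ be a Ptolemy metric space and let $p\in X$ be an arbitrary point. Then the function $\chi_p$ defined for $x,y\in X\setminus\{p\}$ by $$\chi_p(x,y)=\log\left(1+\frac{d(x,y)}{d(p,x)\,d(p,y)}\right)$$ is a metric on $X\setminus\{p\}$.
   Context: A metric space $(X,d)$ is called a Ptolemy space if $d(x_1,x_2)d(x_3,x_4)\leq d(x_1,x_4)d(x_2,x_3)+d(x_1,x_3)d(x_2,x_4)$ for all $x_1,x_2,x_3,x_4\in X$. *)

theory Defs
  imports "HOL-Analysis.Analysis"
begin

locale Ptolemy_space = Metric_space X d
  for X :: "'a set" and d :: "'a \<Rightarrow> 'a \<Rightarrow> real" +
  assumes Ptolemy_inequality:
    "\<lbrakk>x1 \<in> X; x2 \<in> X; x3 \<in> X; x4 \<in> X\<rbrakk>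
      \<Longrightarrow> d x1 x2 * d x3 x4 \<le> d x1 x4 * d x2 x3 + d x1 x3 * d x2 x4"

(* Meant for x and y in X - {p}.  At x = p or y = p the denominator is 0, so by x / 0 = 0
   the value is ln 1 = 0. *)
definition chi :: "('a \<Rightarrow> 'a \<Rightarrow> real) \<Rightarrow> 'a \<Rightarrow> 'a \<Rightarrow> 'a \<Rightarrow> real"
  where "chi d p x y = ln (1 + d x y / (d p x * d p y))"

end

theory Submission
  imports Defs
begin

text \<open>
  The quotient \<open>d x y / (d p x * d p y)\<close> is the distance seen after inversion at \<open>p\<close>.
  Dividing Ptolemy's inequality for \<open>x, z, p, y\<close> by \<open>d p x * d p y * d p z\<close> turns it into
  the triangle inequality for this quotient, so inversion in a Ptolemy space gives a metric
  on the complement of \<open>p\<close>. Composing any metric with \<open>\<lambda>t. ln (1 + t)\<close> gives a metric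
  again: this function is increasing, vanishes only at \<open>0\<close> among nonnegative reals, and is
  subadditive because \<open>1 + s + t \<le> (1 + s) * (1 + t)\<close>.
\<close>

lemma ln_one_plus_subadditive:
  fixes r s t :: real
  assumes "0 \<le> r" "0 \<le> s" "0 \<le> t" "r \<le> s + t"
  shows "ln (1 + r) \<le> ln (1 + s) + ln (1 + t)"
proof -
  have "1 + r \<le> (1 + s) * (1 + t)"
    using assms(4) mult_nonneg_nonneg[OF assms(2,3)] unfolding distrib_left distrib_right by linarith
  then have "ln (1 + r) \<le> ln ((1 + s) * (1 + t))"
    using assms by (intro ln_mono) auto
  also have "\<dots> = ln (1 + s) + ln (1 + t)"
    using assms by (intro ln_mult_pos) auto
  finally show ?thesis .
qed

lemma (in Metric_space) Metric_space_ln_one_plus: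
  "Metric_space M (\<lambda>x y. ln (1 + d x y))"
proof
  fix x y
  show "0 \<le> ln (1 + d x y)"
    by simp
  show "ln (1 + d x y) = ln (1 + d y x)"
    by (simp add: commute)
next
  fix x y
  assume "x \<in> M" "y \<in> M"
  have "ln (1 + d x y) = 0 \<longleftrightarrow> d x y = 0"
    using nonneg[of x y] ln_eq_zero_iff[of "1 + d x y"] by linarith
  then show "ln (1 + d x y) = 0 \<longleftrightarrow> x = y"
    using \<open>x \<in> M\<close> \<open>y \<in> M\<close> by simp
next
  fix x y z
  assume "x \<in> M" "y \<in> M" "z \<in> M"
  then show "ln (1 + d x z) \<le> ln (1 + d x y) + ln (1 + d y z)"
    by (intro ln_one_plus_subadditive triangle) auto
qed

text \<open>
  In Euclidean space, inversion in the unit sphere about \<open>p\<close> multiplies distances by exactly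
  \<open>1 / (d p x * d p y)\<close>; here Ptolemy's inequality takes the place of the ambient geometry.
\<close>

lemma (in Ptolemy_space) Metric_space_inversion:
  assumes "p \<in> X"
  shows "Metric_space (X - {p}) (\<lambda>x y. d x y / (d p x * d p y))"
proof
  fix x y
  show "0 \<le> d x y / (d p x * d p y)"
    by simp
  show "d x y / (d p x * d p y) = d y x / (d p y * d p x)"
    by (simp add: commute mult.commute)
next
  fix x y
  assume "x \<in> X - {p}" "y \<in> X - {p}"
  then show "d x y / (d p x * d p y) = 0 \<longleftrightarrow> x = y"
    using assms by auto
next
  fix x y z
  assume xyz: "x \<in> X - {p}" "y \<in> X - {p}" "z \<in> X - {p}"
  then have pos: "0 < d p x" "0 < d p y" "0 < d p z"
    using assms mdist_pos_less by auto
  \<comment> \<open>Ptolemy's inequality with \<open>x z\<close> and \<open>p y\<close> as the two diagonals.\<close>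
  have "d x z * d p y \<le> d x y * d p z + d y z * d p x"
    using Ptolemy_inequality[of x z p y] xyz assms by (simp add: commute mult.commute)
  then have "d x z * d p y / (d p x * d p y * d p z)
      \<le> (d x y * d p z + d y z * d p x) / (d p x * d p y * d p z)"
    using pos by (intro divide_right_mono) auto
  then show "d x z / (d p x * d p z) \<le> d x y / (d p x * d p y) + d y z / (d p y * d p z)"
    using pos by (simp add: add_divide_distrib mult_ac)
qed

theorem theorem6:
  fixes X :: "'a set" and d :: "'a \<Rightarrow> 'a \<Rightarrow> real" and p :: 'a
  assumes "Ptolemy_space X d"
    and "p \<in> X"
  shows "Metric_space (X - {p}) (chi d p)"
proof -
  have "chi d p = (\<lambda>x y. ln (1 + d x y / (d p x * d p y)))"
    by (intro ext) (rule chi_def)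
  then show ?thesis
    using Metric_space.Metric_space_ln_one_plus
        [OF Ptolemy_space.Metric_space_inversion[OF assms]]
    by simp
qed

end
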